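(* Let $f,g:\mathbb{R}^n\to\mathbb{R}\cup\{\infty\}$ be closed proper convex functions, let $\mathcal{X}\subseteq\mathbb{R}^n$ be a convex set, and assume that the optimal value $\tau_p^*=\inf\{f(x)\mid x\in\mathcal{X},\ g(x)\le 0\}$ is finite (in particular, the problem is feasible). Define, for $u,\tau\in\mathbb{R}$, the value functions $$p(u)=\inf_{x\in\mathcal{X}}\{f(x)\mid g(x)\le u\},\qquad v(\tau)=\inf_{x\in\mathcal{X}}\{g(x)\mid f(x)\le\tau\}.$$ Let $\tau_d^*:=p^{\star\star}(0)$, where $p^{\star\star}$ is the convex biconjugate of $p$; this is the optimal value of the Lagrange dual problem $\sup_{\lambda\le 0}\ \inf_{x\in\mathcal{X}}\{f(x)-\lambda g(x)\}$. Then $$\tau_d^*=\inf\{\tau\in\mathbb{R}\mid v(\tau)\le 0\}\qquad\text{and}\qquad v(\tau)\le 0\ \text{ for all real } \tau>\tau_d^*.$$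
   Context: Infima and suprema are taken in the extended reals $[-\infty,+\infty]$, with $\inf\emptyset=+\infty$ and $\sup\emptyset=-\infty$. In particular $\tau_d^*=-\infty$ is allowed, in which case $\inf\{\tau\mid v(\tau)\le 0\}=-\infty$ means the set is unbounded below. For $p:\mathbb{R}\to[-\infty,+\infty]$, the conjugate is $p^\star(\mu)=\sup_u\{\mu u-p(u)\}$ and the biconjugate is $p^{\star\star}=(p^\star)^\star$, so $p^{\star\star}(0)=\sup_\mu\{-p^\star(\mu)\}$. The Lagrange dual value is understood as $\sup_\lambda \{-F^\star(0,\lambda)\}=\sup_\lambda\inf_{x,u}\{f(x)+\delta_{\mathcal{X}}(x)-\lambda u+\delta_{\mathrm{epi}\,g}(x,u)\}$, where $F(x,u)=f(x)+\delta_{\mathcal{X}}(x)+\delta_{\mathrm{epi}\,g}(x,u)$, $\mathrm{epi}\,g=\{(x,u)\mid g(x)\le u\}$, and $\delta_C$ is the indicator function of $C$ ($0$ on $C$, $+\infty$ off $C$). Equivalently, in $\inf_{x\in\mathcal{X}}\{f(x)-\lambda g(x)\}$ the expression is taken to be $+\infty$ at points where $g(x)=+\infty$ (also for $\lambda=0$). *)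

theory Defs
  imports "HOL-Analysis.Analysis"
begin

text \<open>
  Extended-real-valued functions are functions into \<^typ>\<open>ereal\<close>. It is a complete lattice, so
  the infimum of the empty set is plus infinity and its supremum is minus infinity.
\<close>

definition epi :: "('a \<Rightarrow> ereal) \<Rightarrow> ('a \<times> real) set" where
  "epi h = {(x, u). h x \<le> ereal u}"

text \<open>
  A convex function is one with convex epigraph, a closed function one with closed epigraph.
  Properness contains the requirement that the value minus infinity is never attained, so the
  proper functions all take values in the reals extended by plus infinity only.
\<close>

definition proper_fun :: "('a \<Rightarrow> ereal) \<Rightarrow> bool" where
  "proper_fun h \<longleftrightarrow> (\<forall>x. h x \<noteq> -\<infinity>) \<and> (\<exists>x. h x \<noteq> \<infinity>)"

definition closed_proper_convex :: "('a::real_normed_vector \<Rightarrow> ereal) \<Rightarrow> bool" where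
  "closed_proper_convex h \<longleftrightarrow> closed (epi h) \<and> proper_fun h \<and> convex (epi h)"

definition conjugate :: "('a::real_inner \<Rightarrow> ereal) \<Rightarrow> 'a \<Rightarrow> ereal" where
  "conjugate h y = (SUP x. ereal (inner y x) - h x)"

definition biconjugate :: "('a::real_inner \<Rightarrow> ereal) \<Rightarrow> 'a \<Rightarrow> ereal" where
  "biconjugate h = conjugate (conjugate h)"

text \<open>
  The function \<open>p\<close> is \<open>value_fun f g X\<close>; exchanging objective and constraint, \<open>v\<close> is
  \<open>value_fun g f X\<close>.
\<close>

definition value_fun :: "('a \<Rightarrow> ereal) \<Rightarrow> ('a \<Rightarrow> ereal) \<Rightarrow> 'a set \<Rightarrow> real \<Rightarrow> ereal" where
  "value_fun f g X r = (INF x\<in>{x\<in>X. g x \<le> ereal r}. f x)"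

definition ind_fun :: "'a set \<Rightarrow> 'a \<Rightarrow> ereal" where
  "ind_fun C x = (if x \<in> C then 0 else \<infinity>)"

definition perturb_fun ::
  "('a \<Rightarrow> ereal) \<Rightarrow> ('a \<Rightarrow> ereal) \<Rightarrow> 'a set \<Rightarrow> 'a \<times> real \<Rightarrow> ereal" where
  "perturb_fun f g X = (\<lambda>(x, u). f x + ind_fun X x + ind_fun (epi g) (x, u))"

definition lagrange_dual_value ::
  "('a::real_inner \<Rightarrow> ereal) \<Rightarrow> ('a \<Rightarrow> ereal) \<Rightarrow> 'a set \<Rightarrow> ereal" where
  "lagrange_dual_value f g X = (SUP \<mu>::real. - conjugate (perturb_fun f g X) (0, \<mu>))"

text \<open>
  The Lagrangian is plus infinity wherever \<open>g\<close> is. The case distinction is needed for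
  \<open>\<mu> = 0\<close>, since \<open>0 * \<infinity> = 0\<close> in \<^typ>\<open>ereal\<close>.
\<close>

definition lagrangian ::
  "('a \<Rightarrow> ereal) \<Rightarrow> ('a \<Rightarrow> ereal) \<Rightarrow> real \<Rightarrow> 'a \<Rightarrow> ereal" where
  "lagrangian f g \<mu> x = (if g x = \<infinity> then \<infinity> else f x - ereal \<mu> * g x)"

end

theory Submission imports Defs begin

text \<open>
  If \<open>v(\<tau>) > 0\<close>, then for some \<open>\<epsilon> > 0\<close> the convex set of all \<open>(u, t)\<close> with \<open>g(x) \<le> u\<close> and
  \<open>f(x) \<le> t\<close> for some \<open>x \<in> X\<close> misses the quadrant below \<open>(\<epsilon>, \<tau>)\<close>. A separating line has a
  nonnegative normal \<open>(a, b)\<close>; it is not vertical, because a feasible point exists and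
  \<open>\<epsilon> > 0\<close>, so \<open>\<mu> = -a/b\<close> is a multiplier with dual value at least \<open>\<tau>\<close>. Conversely, if
  \<open>v(\<tau>) \<le> 0\<close>, then evaluating the Lagrangian at points with \<open>f(x) \<le> \<tau>\<close> and \<open>g(x) \<le> \<epsilon>\<close>, as
  \<open>\<epsilon>\<close> tends to 0, bounds every dual value by \<open>\<tau>\<close>.
\<close>

text \<open>Since \<open>a\<close> is finite, no difference of two equal infinities arises, whatever
  \<open>x\<close> and \<open>c\<close> are.\<close>

lemma ereal_diff_le_swap: "ereal a - x \<le> c \<longleftrightarrow> ereal a - c \<le> x"
  by (cases x; cases c) auto

text \<open>The swap turns the bound on the conjugate into a lower bound on an infimum, so both
  extrema dissolve into quantifiers over pairs in \<open>epi g\<close>.\<close>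

lemma conjugate_value_fun_le_iff:
  "conjugate (value_fun f g X) \<mu> \<le> c \<longleftrightarrow>
    (\<forall>x\<in>X. \<forall>u. g x \<le> ereal u \<longrightarrow> ereal (\<mu> * u) - f x \<le> c)"
proof -
  have "conjugate (value_fun f g X) \<mu> \<le> c \<longleftrightarrow>
      (\<forall>u. ereal (\<mu> * u) - c \<le> value_fun f g X u)"
    by (simp add: conjugate_def SUP_le_iff ereal_diff_le_swap[of _ _ c])
  also have "\<dots> \<longleftrightarrow> (\<forall>u. \<forall>x\<in>{x\<in>X. g x \<le> ereal u}. ereal (\<mu> * u) - f x \<le> c)"
    by (simp add: value_fun_def le_INF_iff ereal_diff_le_swap[of _ c])
  finally show ?thesis by auto
qed

lemma le_conjugate_value_fun:
  assumes "x \<in> X" "g x \<le> ereal u"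
  shows "ereal (\<mu> * u) - f x \<le> conjugate (value_fun f g X) \<mu>"
proof -
  have "\<forall>x\<in>X. \<forall>u. g x \<le> ereal u \<longrightarrow> ereal (\<mu> * u) - f x \<le> conjugate (value_fun f g X) \<mu>"
    by (simp flip: conjugate_value_fun_le_iff)
  with assms show ?thesis by simp
qed

lemma conjugate_perturb_fun_le_iff:
  "conjugate (perturb_fun f g X) (0, \<mu>) \<le> c \<longleftrightarrow>
    (\<forall>x\<in>X. \<forall>u. g x \<le> ereal u \<longrightarrow> ereal (\<mu> * u) - f x \<le> c)"
  unfolding conjugate_def SUP_le_iff
  by (auto simp: perturb_fun_def ind_fun_def epi_def)

text \<open>Minimising the perturbation function over \<open>x\<close> gives the value function, so
  the two conjugates have the same upper bounds.\<close>

lemma conjugate_perturb_fun: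
  "conjugate (perturb_fun f g X) (0, \<mu>) = conjugate (value_fun f g X) \<mu>"
  by (meson conjugate_perturb_fun_le_iff conjugate_value_fun_le_iff order_antisym order_refl)

lemma biconjugate_0: "biconjugate h 0 = (SUP \<mu>. - conjugate h \<mu>)"
  by (simp add: biconjugate_def conjugate_def[of "conjugate h"] minus_ereal_def
      flip: zero_ereal_def)

text \<open>For \<open>\<mu> \<le> 0\<close> the binding case is the least admissible
  \<open>u\<close>, namely \<open>g x\<close>. If \<open>g x\<close> is plus infinity, no
  \<open>u\<close> is admissible, matching the infinite Lagrangian.\<close>

lemma le_lagrangian_iff:
  assumes "\<mu> \<le> 0" and "g x \<noteq> -\<infinity>"
  shows "c \<le> lagrangian f g \<mu> x \<longleftrightarrow>
    (\<forall>u. g x \<le> ereal u \<longrightarrow> ereal (\<mu> * u) - f x \<le> - c)"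
proof (cases "g x")
  case (real r)
  have *: "ereal s - f x \<le> - c \<longleftrightarrow> c \<le> f x - ereal s" for s
    by (cases "f x"; cases c) auto
  have "c \<le> f x - ereal (\<mu> * u)" if "c \<le> f x - ereal (\<mu> * r)" "r \<le> u" for u
  proof -
    have "\<mu> * u \<le> \<mu> * r"
      using that(2) assms(1) by (rule mult_left_mono_neg)
    then have "f x - ereal (\<mu> * r) \<le> f x - ereal (\<mu> * u)"
      by (intro ereal_minus_mono) auto
    with that(1) show ?thesis by (rule order_trans)
  qed
  then show ?thesis
    using real by (auto simp: lagrangian_def *)
qed (use assms in \<open>auto simp: lagrangian_def\<close>)

lemma INF_lagrangian:
  assumes "\<mu> \<le> 0" and "\<And>x. g x \<noteq> -\<infinity>"
  shows "(INF x\<in>X. lagrangian f g \<mu> x) = - conjugate (value_fun f g X) \<mu>"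
proof -
  have "c \<le> (INF x\<in>X. lagrangian f g \<mu> x) \<longleftrightarrow> conjugate (value_fun f g X) \<mu> \<le> - c" for c
    by (simp add: le_INF_iff le_lagrangian_iff assms conjugate_value_fun_le_iff)
  also have "conjugate (value_fun f g X) \<mu> \<le> - c \<longleftrightarrow> c \<le> - conjugate (value_fun f g X) \<mu>" for c
    using ereal_minus_le_minus[of "- c"] by simp
  finally have "c \<le> (INF x\<in>X. lagrangian f g \<mu> x) \<longleftrightarrow> c \<le> - conjugate (value_fun f g X) \<mu>" for c .
  then show ?thesis
    by (meson order_antisym order_refl)
qed

text \<open>A feasible point stays admissible as \<open>u\<close> grows, and
  \<open>\<mu> * u\<close> is then unbounded. Hence positive multipliers contribute minus infinity
  to the dual.\<close>

lemma conjugate_value_fun_pos: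
  assumes "x \<in> X" "g x \<le> 0" "f x < \<infinity>" "f x \<noteq> -\<infinity>" "\<mu> > 0"
  shows "conjugate (value_fun f g X) \<mu> = \<infinity>"
proof -
  obtain t where t: "f x = ereal t"
    using assms by (cases "f x") auto
  have "ereal c \<le> conjugate (value_fun f g X) \<mu>" for c
  proof -
    \<comment> \<open>The \<open>0\<close> keeps \<open>x\<close> admissible; the quotient ensures
      \<open>c + t \<le> \<mu> * u\<close>.\<close>
    define u where "u = max 0 ((c + t) / \<mu>)"
    have "g x \<le> ereal u"
      using assms(2) by (rule order_trans) (simp add: u_def zero_ereal_def)
    then have "ereal (\<mu> * u) - f x \<le> conjugate (value_fun f g X) \<mu>"
      using assms(1) by (intro le_conjugate_value_fun)
    moreover have "c + t \<le> \<mu> * u"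
    proof -
      have "(c + t) / \<mu> \<le> u" by (simp add: u_def)
      then show ?thesis
        using assms(5) by (simp add: pos_divide_le_eq mult.commute)
    qed
    then have "ereal c \<le> ereal (\<mu> * u) - f x"
      by (simp add: t)
    ultimately show ?thesis by (rule order_trans[rotated])
  qed
  then show ?thesis
    by (rule ereal_top)
qed

text \<open>Weak duality with slack: the infimum \<open>v(\<tau>)\<close> need not be attained, so
  the bound is tested at points with \<open>g x < \<epsilon>\<close>.\<close>

lemma dual_value_le:
  assumes "value_fun g f X \<tau> \<le> 0" "\<mu> \<le> 0"
  shows "- conjugate (value_fun f g X) \<mu> \<le> ereal \<tau>"
proof (rule ereal_le_epsilon2)
  fix e :: real assume "e > 0"
  \<comment> \<open>Chosen so that \<open>- \<mu> * \<epsilon> \<le> e\<close>; the \<open>1\<close>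
    keeps the denominator positive when \<open>\<mu> = 0\<close>.\<close>
  define \<epsilon> where "\<epsilon> = e / (1 - \<mu>)"
  have "\<epsilon> > 0"
    using \<open>e > 0\<close> assms(2) by (simp add: \<epsilon>_def)
  have "value_fun g f X \<tau> < ereal \<epsilon>"
    using assms(1) \<open>\<epsilon> > 0\<close> by (simp add: order_le_less_trans)
  then obtain x where x: "x \<in> X" "f x \<le> ereal \<tau>" "g x < ereal \<epsilon>"
    by (auto simp: value_fun_def INF_less_iff)
  then have "ereal (\<mu> * \<epsilon>) - f x \<le> conjugate (value_fun f g X) \<mu>"
    by (intro le_conjugate_value_fun less_imp_le)
  moreover have "ereal (\<mu> * \<epsilon>) - ereal \<tau> \<le> ereal (\<mu> * \<epsilon>) - f x"
    using x(2) by (intro ereal_minus_mono) auto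
  ultimately have "ereal (\<mu> * \<epsilon> - \<tau>) \<le> conjugate (value_fun f g X) \<mu>"
    by simp
  then have "- conjugate (value_fun f g X) \<mu> \<le> ereal (\<tau> - \<mu> * \<epsilon>)"
    by (subst ereal_uminus_le_reorder) simp
  also have "\<dots> \<le> ereal \<tau> + ereal e"
    using \<open>e > 0\<close> assms(2) by (simp add: \<epsilon>_def field_simps)
  finally show "- conjugate (value_fun f g X) \<mu> \<le> ereal \<tau> + ereal e" .
qed

text \<open>The same convex combination of two witnesses is again a witness.\<close>

lemma convex_achievable:
  assumes "convex (epi f)" "convex (epi g)" "convex X"
  shows "convex {(u, t). \<exists>x\<in>X. g x \<le> ereal u \<and> f x \<le> ereal t}"
proof (rule convexI, clarsimp)
  fix u t u' t' x y and a b :: real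
  assume *: "0 \<le> a" "0 \<le> b" "a + b = 1" "x \<in> X" "y \<in> X"
    and "g x \<le> ereal u" "f x \<le> ereal t" "g y \<le> ereal u'" "f y \<le> ereal t'"
  then have "a *\<^sub>R (x, u) + b *\<^sub>R (y, u') \<in> epi g" "a *\<^sub>R (x, t) + b *\<^sub>R (y, t') \<in> epi f"
    by (intro convexD assms; simp add: epi_def)+
  moreover have "a *\<^sub>R x + b *\<^sub>R y \<in> X"
    using * assms(3) by (intro convexD)
  ultimately show "\<exists>z\<in>X. g z \<le> ereal (a * u + b * u') \<and> f z \<le> ereal (a * t + b * t')"
    by (auto simp: epi_def)
qed

lemma exists_multiplier:
  assumes "convex (epi f)" "convex (epi g)" "convex X"
    and x0: "x0 \<in> X" "g x0 \<le> 0" "f x0 < \<infinity>"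
    and f: "\<And>x. f x \<noteq> -\<infinity>"
    and v: "value_fun g f X \<tau> > 0"
  shows "\<exists>\<mu>\<le>0. ereal \<tau> \<le> - conjugate (value_fun f g X) \<mu>"
proof -
  obtain \<epsilon> where \<epsilon>: "\<epsilon> > 0" "ereal \<epsilon> < value_fun g f X \<tau>"
    using ereal_dense2[OF v] by auto
  define C where "C = {(u, t). \<exists>x\<in>X. g x \<le> ereal u \<and> f x \<le> ereal t}"
  define Q where "Q = {..\<epsilon>} \<times> {..\<tau>}"
  obtain t0 where "f x0 = ereal t0"
    using x0 f[of x0] by (cases "f x0") auto
  then have x0C: "(0, t0) \<in> C"
    using x0 by (auto simp: C_def zero_ereal_def)
  have "C \<inter> Q = {}"
  proof -
    \<comment> \<open>Points with \<open>f x \<le> \<tau>\<close> satisfy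
      \<open>g x \<ge> v(\<tau>) > \<epsilon>\<close>, so \<open>C\<close> misses even the closed
      quadrant.\<close>
    have "g x > ereal u" if "x \<in> X" "f x \<le> ereal t" "t \<le> \<tau>" "u \<le> \<epsilon>" for x u t
    proof -
      have "f x \<le> ereal \<tau>"
        using that(2,3) by (meson ereal_less_eq(3) order_trans)
      then have "value_fun g f X \<tau> \<le> g x"
        using that(1) by (auto simp: value_fun_def intro: INF_lower)
      then show ?thesis
        using \<epsilon>(2) that(4) by (meson ereal_less_eq(3) order_le_less_trans order_less_le_trans)
    qed
    then show ?thesis
      by (force simp: C_def Q_def)
  qed
  moreover have "convex C" "convex Q"
    using convex_achievable[OF assms(1-3)] by (auto simp: C_def Q_def intro: convex_Times)
  moreover have "C \<noteq> {}" "Q \<noteq> {}"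
    using x0C by (auto simp: Q_def)
  ultimately obtain n :: "real \<times> real" and k
    where n: "n \<noteq> 0" "\<forall>z\<in>Q. inner n z \<le> k" "\<forall>z\<in>C. inner n z \<ge> k"
    using separating_hyperplane_sets[of Q C] by blast
  obtain a b where ab: "n = (a, b)"
    by fastforce
  have Q: "a * u + b * t \<le> k" if "u \<le> \<epsilon>" "t \<le> \<tau>" for u t
    using n(2) that by (auto simp: ab Q_def)
  have C: "a * u + b * t \<ge> k" if "(u, t) \<in> C" for u t
    using n(3) that by (auto simp: ab)
  text \<open>\<open>C\<close> is upward closed, so a negative component of the normal would make the functional
    unbounded below on \<open>C\<close>.\<close>
  have C_up: "(u + r, t + s) \<in> C" if "(u, t) \<in> C" "r \<ge> 0" "s \<ge> 0" for u t r s
  proof -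
    have "ereal u \<le> ereal (u + r)" "ereal t \<le> ereal (t + s)"
      using that by auto
    then show ?thesis
      using that(1) unfolding C_def by (blast intro: order_trans)
  qed
  have "a \<ge> 0"
  proof (rule ccontr)
    assume "\<not> a \<ge> 0"
    then have "a < 0" by simp
    \<comment> \<open>The shift brings the functional at \<open>(r, t0)\<close> down to at most
      \<open>k - 1\<close>.\<close>
    define r where "r = max 0 ((k - b * t0 - 1) / a)"
    have "(k - b * t0 - 1) / a \<le> r" by (simp add: r_def)
    then have "a * r \<le> k - b * t0 - 1"
      using \<open>a < 0\<close> by (metis mult.commute neg_divide_le_eq)
    moreover have "a * (0 + r) + b * (t0 + 0) \<ge> k"
      by (intro C C_up x0C) (auto simp: r_def)
    ultimately show False by simp
  qed
  have "b \<ge> 0"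
  proof (rule ccontr)
    assume "\<not> b \<ge> 0"
    then have "b < 0" by simp
    define r where "r = max 0 ((k - b * t0 - 1) / b)"
    have "(k - b * t0 - 1) / b \<le> r" by (simp add: r_def)
    then have "b * r \<le> k - b * t0 - 1"
      using \<open>b < 0\<close> by (metis mult.commute neg_divide_le_eq)
    moreover have "a * (0 + 0) + b * (t0 + r) \<ge> k"
      by (intro C C_up x0C) (auto simp: r_def)
    ultimately show False by (simp add: distrib_left)
  qed
  \<comment> \<open>With \<open>b = 0\<close>, separation gives
    \<open>a * \<epsilon> \<le> k \<le> 0\<close>, so the whole normal vanishes. Strict feasibility
    of \<open>x0\<close> at level \<open>\<epsilon>\<close> takes the place of a Slater
    condition.\<close>
  have "b \<noteq> 0"
  proof
    assume "b = 0"
    then have "a * \<epsilon> \<le> 0"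
      using Q[of \<epsilon> \<tau>] C[OF x0C] by simp
    then show False
      using \<open>a \<ge> 0\<close> \<open>b = 0\<close> \<epsilon>(1) n(1) by (simp add: ab zero_prod_def mult_le_0_iff)
  qed
  \<comment> \<open>This is the slope of the separating line. Dropping
    \<open>a * \<epsilon> \<ge> 0\<close> and dividing by \<open>b\<close> puts \<open>C\<close>
    above the line of this slope through \<open>(0, \<tau>)\<close>.\<close>
  define \<mu> where "\<mu> = - a / b"
  have "\<tau> \<le> t - \<mu> * u" if "(u, t) \<in> C" for u t
  proof -
    have "a * \<epsilon> + b * \<tau> \<le> a * u + b * t"
      using Q[of \<epsilon> \<tau>] C[OF that] by simp
    then have "b * \<tau> \<le> a * u + b * t"
      using \<open>a \<ge> 0\<close> \<epsilon>(1) by (smt (verit) mult_nonneg_nonneg)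
    then show ?thesis
      using \<open>b \<ge> 0\<close> \<open>b \<noteq> 0\<close> by (simp add: \<mu>_def field_simps)
  qed
  \<comment> \<open>If \<open>f x\<close> is finite, then \<open>(u, f x)\<close> lies in
    \<open>C\<close>; otherwise the left side is minus infinity.\<close>
  then have "ereal (\<mu> * u) - f x \<le> ereal (- \<tau>)" if "x \<in> X" "g x \<le> ereal u" for x u
    using that f[of x] by (cases "f x") (fastforce simp: C_def)+
  then have "conjugate (value_fun f g X) \<mu> \<le> - ereal \<tau>"
    by (simp add: conjugate_value_fun_le_iff)
  then have "ereal \<tau> \<le> - conjugate (value_fun f g X) \<mu>"
    using ereal_minus_le_minus by fastforce
  moreover have "\<mu> \<le> 0"
    using \<open>a \<ge> 0\<close> \<open>b \<ge> 0\<close> by (simp add: \<mu>_def)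
  ultimately show ?thesis by blast
qed

theorem theorem5p1:
  fixes f g :: "real ^ 'n \<Rightarrow> ereal" and X :: "(real ^ 'n) set"
  assumes "closed_proper_convex f"
    and "closed_proper_convex g"
    and "convex X"
    and "\<bar>INF x\<in>{x\<in>X. g x \<le> 0}. f x\<bar> \<noteq> \<infinity>"
  shows "biconjugate (value_fun f g X) 0 = lagrange_dual_value f g X
    \<and> biconjugate (value_fun f g X) 0 = (SUP \<mu>\<in>{..0::real}. INF x\<in>X. lagrangian f g \<mu> x)
    \<and> biconjugate (value_fun f g X) 0 = Inf (ereal ` {\<tau>. value_fun g f X \<tau> \<le> 0})
    \<and> (\<forall>\<tau>::real. ereal \<tau> > biconjugate (value_fun f g X) 0 \<longrightarrow> value_fun g f X \<tau> \<le> 0)"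
proof -
  let ?p = "value_fun f g X" and ?v = "value_fun g f X"
  let ?d = "biconjugate ?p 0"
  have f: "f x \<noteq> -\<infinity>" and g: "g x \<noteq> -\<infinity>" for x
    using assms(1,2) by (auto simp: closed_proper_convex_def proper_fun_def)
  have "(INF x\<in>{x\<in>X. g x \<le> 0}. f x) < \<infinity>"
    using assms(4) by auto
  then obtain x0 where x0: "x0 \<in> X" "g x0 \<le> 0" "f x0 < \<infinity>"
    unfolding INF_less_iff by auto
  have d: "?d = (SUP \<mu>\<in>{..0}. - conjugate ?p \<mu>)"
    unfolding biconjugate_0
  proof (rule antisym)
    show "(SUP \<mu>. - conjugate ?p \<mu>) \<le> (SUP \<mu>\<in>{..0}. - conjugate ?p \<mu>)"
    proof (rule SUP_least)
      fix \<mu> :: real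
      show "- conjugate ?p \<mu> \<le> (SUP \<mu>\<in>{..0}. - conjugate ?p \<mu>)"
      proof (cases "\<mu> \<le> 0")
        case True
        then show ?thesis by (intro SUP_upper) auto
      next
        case False
        then show ?thesis
          using conjugate_value_fun_pos[where f = f and g = g, OF x0 f] by simp
      qed
    qed
  qed (rule SUP_subset_mono; simp)
  have "?d = lagrange_dual_value f g X"
    by (simp add: biconjugate_0 lagrange_dual_value_def conjugate_perturb_fun)
  moreover have "?d = (SUP \<mu>\<in>{..0::real}. INF x\<in>X. lagrangian f g \<mu> x)"
    unfolding d by (intro SUP_cong refl) (simp add: INF_lagrangian g)
  moreover have strong: "?v \<tau> \<le> 0" if "?d < ereal \<tau>" for \<tau>
  proof (rule ccontr)
    assume "\<not> ?v \<tau> \<le> 0"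
    then have "?v \<tau> > 0" by simp
    moreover have "convex (epi f)" "convex (epi g)"
      using assms(1,2) by (auto simp: closed_proper_convex_def)
    ultimately obtain \<mu> where "\<mu> \<le> 0" "ereal \<tau> \<le> - conjugate ?p \<mu>"
      using exists_multiplier[of f g X x0 \<tau>] x0 f assms(3) by metis
    then have "ereal \<tau> \<le> ?d"
      unfolding d by (auto intro: SUP_upper2)
    with that show False by simp
  qed
  moreover have "?d = Inf (ereal ` {\<tau>. ?v \<tau> \<le> 0})"
  proof (rule antisym)
    show "?d \<le> Inf (ereal ` {\<tau>. ?v \<tau> \<le> 0})"
      unfolding d by (auto intro!: INF_greatest SUP_least dual_value_le)
    \<comment> \<open>By \<open>strong\<close>, a real strictly between the two values would belong
      to the set whose infimum exceeds it. Density also covers \<open>?d\<close> equal to minus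
      infinity.\<close>
    show "Inf (ereal ` {\<tau>. ?v \<tau> \<le> 0}) \<le> ?d"
    proof (rule ccontr)
      assume "\<not> Inf (ereal ` {\<tau>. ?v \<tau> \<le> 0}) \<le> ?d"
      then obtain \<tau> where \<tau>: "?d < ereal \<tau>" "ereal \<tau> < Inf (ereal ` {\<tau>. ?v \<tau> \<le> 0})"
        using ereal_dense2 by (meson not_le)
      then have "Inf (ereal ` {\<tau>. ?v \<tau> \<le> 0}) \<le> ereal \<tau>"
        using strong by (intro Inf_lower) auto
      with \<tau>(2) show False by simp
    qed
  qed
  ultimately show ?thesis by blast
qed

end
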